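(* There exists a $4$-block $n$-fold IP with $s_B=s_D=1$ such that $\|\mathbf g\|_\infty=\Omega(n)$ for some Graver basis element $\mathbf g$. That is, there exist fixed integer matrices $A,B,C,D$ (independent of $n$) with $s_B=s_D=1$ such that the $4$-block $n$-fold matrices $H^{(n)}$ built from them have Graver basis elements $\mathbf g^{(n)}\in\mathcal G(H^{(n)})$ with $\|\mathbf g^{(n)}\|_\infty=\Omega(n)$ as a function of $n$.
   Context: A $4$-block $n$-fold IP is an integer program whose constraint matrix is $$H^{(n)}=\begin{pmatrix} C & D & D & \cdots & D\\ B & A & 0 & & 0\\ B & 0 & A & & 0\\ \vdots & & & \ddots & \\ B & 0 & 0 & & A\end{pmatrix}$$ with $n$ copies of $D$ and $n$ copies of $A$, where $A\in\mathbb Z^{s_A\times t_A}$, $B\in\mathbb Z^{s_B\times t_B}$, $C\in\mathbb Z^{s_C\times t_C}$, $D\in\mathbb Z^{s_D\times t_D}$ (so $s_C=s_D$, $s_A=s_B$, $t_B=t_C$, $t_A=t_D$). The Graver basis $\mathcal G(H)$ of an integer matrix $H$ is the finite set of $\sqsubseteq$-minimal elements of $\{\mathbf x \text{ integral}: H\mathbf x=\mathbf 0\}\setminus\{\mathbf 0\}$, where $\mathbf x\sqsubseteq\mathbf y$ iff $x_iy_i\ge 0$ and $|x_i|\le|y_i|$ for every coordinate $i$. *)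

theory Defs
  imports
    "Jordan_Normal_Form.Matrix"
    "HOL-Library.Landau_Symbols"
begin

definition four_block_data :: "int mat \<Rightarrow> int mat \<Rightarrow> int mat \<Rightarrow> int mat \<Rightarrow> bool" where
  "four_block_data A B C D \<longleftrightarrow>
     dim_row C = dim_row D \<and> dim_row A = dim_row B \<and>
     dim_col B = dim_col C \<and> dim_col A = dim_col D \<and>
     0 < dim_row A \<and> 0 < dim_row D \<and> 0 < dim_col A \<and> 0 < dim_col B"

definition nfold_matrix ::
  "int mat \<Rightarrow> int mat \<Rightarrow> int mat \<Rightarrow> int mat \<Rightarrow> nat \<Rightarrow> int mat" where
  "nfold_matrix A B C D n =
     four_block_mat
       C
       (mat (dim_row D) (n * dim_col D) (\<lambda>(i, j). D $$ (i, j mod dim_col D)))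
       (mat (n * dim_row B) (dim_col B) (\<lambda>(i, j). B $$ (i mod dim_row B, j)))
       (diag_block_mat (replicate n A))"

definition conformal_le :: "int vec \<Rightarrow> int vec \<Rightarrow> bool" (infix "\<sqsubseteq>\<^sub>c" 50) where
  "x \<sqsubseteq>\<^sub>c y \<longleftrightarrow> dim_vec x = dim_vec y \<and>
     (\<forall>i < dim_vec x. 0 \<le> x $ i * y $ i \<and> \<bar>x $ i\<bar> \<le> \<bar>y $ i\<bar>)"

definition nonzero_kernel :: "int mat \<Rightarrow> int vec set" where
  "nonzero_kernel H =
     {x \<in> carrier_vec (dim_col H). H *\<^sub>v x = 0\<^sub>v (dim_row H)} - {0\<^sub>v (dim_col H)}"

definition graver_basis :: "int mat \<Rightarrow> int vec set" where
  "graver_basis H =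
     {g \<in> nonzero_kernel H. \<forall>y \<in> nonzero_kernel H. y \<sqsubseteq>\<^sub>c g \<longrightarrow> y = g}"

text \<open>The element 0 only serves to make the norm of the empty vector well defined.\<close>

definition inf_norm :: "int vec \<Rightarrow> int" where
  "inf_norm x = Max (insert 0 ((\<lambda>i. \<bar>x $ i\<bar>) ` {..<dim_vec x}))"

end

theory Submission
  imports Defs
begin

text \<open>
  Single-row blocks already suffice to make the kernel of the \<open>n\<close>-fold matrix a line. Let
  the first-stage variables be \<open>(x\<^sub>0, x\<^sub>1)\<close> and give each brick a single variable \<open>y\<^sub>i\<close>. With
  \<open>A = (-1)\<close> and \<open>B = (1 0)\<close> every brick row reads \<open>y\<^sub>i = x\<^sub>0\<close>, so all bricks copy the
  same value; with \<open>C = (0 -1)\<close> and \<open>D = (1)\<close> the linking row reads \<open>x\<^sub>1 = y\<^sub>0 + \<dots> + y\<^bsub>n-1\<^esub>\<close>,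
  so \<open>x\<^sub>1\<close> accumulates these copies. Hence the integral kernel consists of the multiples of
  \<open>(1, n, 1, \<dots>, 1)\<close> (\<open>kernel_nfold_copy_matrix\<close>). Since its first entry is \<open>1\<close>, the factor
  of an integral multiple is an integer, and a nonzero multiple lies conformally below the vector
  only if the factor is \<open>1\<close>. The vector is therefore a Graver basis element
  (\<open>copy_sum_vec_in_graver_basis\<close>), and its norm is at least \<open>n\<close>.
\<close>

definition copy_A :: "int mat" where "copy_A = mat 1 1 (\<lambda>_. -1)"
definition copy_B :: "int mat" where "copy_B = mat 1 2 (\<lambda>(i, j). if j = 0 then 1 else 0)"
definition copy_C :: "int mat" where "copy_C = mat 1 2 (\<lambda>(i, j). if j = 0 then 0 else -1)"
definition copy_D :: "int mat" where "copy_D = mat 1 1 (\<lambda>_. 1)"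

definition copy_sum_vec :: "nat \<Rightarrow> int vec" where
  "copy_sum_vec n = vec (n + 2) (\<lambda>i. if i = 1 then int n else 1)"

lemma diag_block_mat_replicate_1x1:
  fixes a :: "'a :: semiring_1"
  shows "diag_block_mat (replicate n (mat 1 1 (\<lambda>_. a))) = a \<cdot>\<^sub>m 1\<^sub>m n"
proof (induction n)
  case 0
  show ?case by (intro eq_matI) auto
next
  case (Suc n)
  show ?case
    by (intro eq_matI) (auto simp: Suc[unfolded One_nat_def] Let_def)
qed

text \<open>
  The diagonal part is \<open>-1\<close> times the identity, which puts the entry of brick \<open>i - 1\<close>, in row
  \<open>i\<close>, at column \<open>i + 1\<close>: one linking row, but two first-stage columns, precede the bricks.
\<close>

lemma nfold_copy_matrix:
  "nfold_matrix copy_A copy_B copy_C copy_D n =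
     mat (n + 1) (n + 2) (\<lambda>(i, j).
       if i = 0 then (if j = 0 then 0 else if j = 1 then -1 else 1)
       else (if j = 0 then 1 else if j = i + 1 then -1 else 0))"
  unfolding nfold_matrix_def copy_A_def diag_block_mat_replicate_1x1
  by (intro eq_matI) (auto simp: copy_B_def copy_C_def copy_D_def)

lemma nfold_copy_matrix_mult_vec:
  assumes "v \<in> carrier_vec (n + 2)"
  shows "nfold_matrix copy_A copy_B copy_C copy_D n *\<^sub>v v =
    vec (n + 1) (\<lambda>i. if i = 0 then (\<Sum>j<n. v $ (j + 2)) - v $ 1 else v $ 0 - v $ (i + 1))"
proof (intro eq_vecI)
  fix i
  assume "i < dim_vec (vec (n + 1)
    (\<lambda>i. if i = 0 then (\<Sum>j<n. v $ (j + 2)) - v $ 1 else v $ 0 - v $ (i + 1)))"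
  then have i: "i < n + 1" by simp
  have dim: "dim_vec v = Suc (Suc n)" using assms by simp
  show "(nfold_matrix copy_A copy_B copy_C copy_D n *\<^sub>v v) $ i =
    vec (n + 1) (\<lambda>i. if i = 0 then (\<Sum>j<n. v $ (j + 2)) - v $ 1 else v $ 0 - v $ (i + 1)) $ i"
  proof (cases i)
    case 0
    then show ?thesis
      using i dim
      by (simp add: nfold_copy_matrix scalar_prod_def sum.atLeast0_lessThan_Suc_shift
          lessThan_atLeast0 del: sum.op_ivl_Suc)
  next
    case (Suc k)
    have "(\<Sum>j = 0..<n. (if j = k then -1 else 0) * v $ Suc (Suc j)) =
        (\<Sum>j = 0..<n. if j = k then - v $ Suc (Suc j) else 0)"
      by (intro sum.cong) auto
    also have "\<dots> = - v $ Suc (Suc k)"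
      using i Suc by simp
    finally show ?thesis
      using i dim Suc
      by (simp add: nfold_copy_matrix scalar_prod_def sum.atLeast0_lessThan_Suc_shift
          del: sum.op_ivl_Suc)
  qed
qed (simp add: nfold_copy_matrix)

text \<open>
  The brick rows propagate the value of the first coordinate to all bricks, and the linking
  row then determines the second coordinate, so nothing but the first coordinate is free.
\<close>

lemma kernel_nfold_copy_matrix:
  assumes "v \<in> carrier_vec (n + 2)"
  shows "nfold_matrix copy_A copy_B copy_C copy_D n *\<^sub>v v = 0\<^sub>v (n + 1) \<longleftrightarrow>
    v = (v $ 0) \<cdot>\<^sub>v copy_sum_vec n"
proof
  assume "nfold_matrix copy_A copy_B copy_C copy_D n *\<^sub>v v = 0\<^sub>v (n + 1)"
  then have product: "vec (n + 1)
      (\<lambda>i. if i = 0 then (\<Sum>j<n. v $ (j + 2)) - v $ 1 else v $ 0 - v $ (i + 1)) = 0\<^sub>v (n + 1)"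
    by (simp only: nfold_copy_matrix_mult_vec[OF assms])
  have rows: "(if i = 0 then (\<Sum>j<n. v $ (j + 2)) - v $ 1 else v $ 0 - v $ (i + 1)) = 0"
    if "i < n + 1" for i
    using that arg_cong[OF product, of "\<lambda>w. w $ i"] by simp
  have brick: "v $ (j + 2) = v $ 0" if "j < n" for j
    using rows[of "j + 1"] that by simp
  have link: "v $ 1 = int n * v $ 0"
    using rows[of 0] brick by simp
  show "v = (v $ 0) \<cdot>\<^sub>v copy_sum_vec n"
  proof (intro eq_vecI)
    fix i
    assume "i < dim_vec ((v $ 0) \<cdot>\<^sub>v copy_sum_vec n)"
    then have "i < n + 2" by (simp add: copy_sum_vec_def)
    moreover consider "i = 0" | "i = 1" | j where "i = j + 2"
      by (metis One_nat_def add_2_eq_Suc' not0_implies_Suc)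
    ultimately show "v $ i = ((v $ 0) \<cdot>\<^sub>v copy_sum_vec n) $ i"
      using link brick by cases (auto simp: copy_sum_vec_def)
  qed (use assms in \<open>simp add: copy_sum_vec_def\<close>)
next
  assume v: "v = (v $ 0) \<cdot>\<^sub>v copy_sum_vec n"
  have entry: "v $ i = v $ 0 * (if i = 1 then int n else 1)" if "i < n + 2" for i
    using that arg_cong[OF v, of "\<lambda>w. w $ i"] by (simp add: copy_sum_vec_def)
  have "v $ 1 = v $ 0 * int n"
    using entry[of 1] by simp
  moreover have "v $ (i + 2) = v $ 0" if "i < n" for i
    using entry[of "i + 2"] that by simp
  moreover have "v $ (i + 1) = v $ 0" if "0 < i" "i < n + 1" for i
    using entry[of "i + 1"] that by simp
  ultimately show "nfold_matrix copy_A copy_B copy_C copy_D n *\<^sub>v v = 0\<^sub>v (n + 1)"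
    unfolding nfold_copy_matrix_mult_vec[OF assms] by (intro eq_vecI) auto
qed

lemma copy_sum_vec_in_graver_basis:
  "copy_sum_vec n \<in> graver_basis (nfold_matrix copy_A copy_B copy_C copy_D n)"
proof -
  let ?H = "nfold_matrix copy_A copy_B copy_C copy_D n"
  let ?g = "copy_sum_vec n"
  have dims: "dim_row ?H = n + 1" "dim_col ?H = n + 2"
    by (simp_all add: nfold_copy_matrix)
  have g: "?g \<in> carrier_vec (n + 2)" and g0: "?g $ 0 = 1"
    by (simp_all add: copy_sum_vec_def)
  have "?g \<noteq> 0\<^sub>v (n + 2)"
    using g0 by auto
  then have "?g \<in> nonzero_kernel ?H"
    using g g0 kernel_nfold_copy_matrix[OF g] by (simp add: nonzero_kernel_def dims)
  moreover have "y = ?g" if y: "y \<in> nonzero_kernel ?H" and le: "y \<sqsubseteq>\<^sub>c ?g" for y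
  proof -
    have carrier: "y \<in> carrier_vec (n + 2)" and nz: "y \<noteq> 0\<^sub>v (n + 2)"
      and multiple: "y = (y $ 0) \<cdot>\<^sub>v ?g"
      using y kernel_nfold_copy_matrix[of y n] by (auto simp: nonzero_kernel_def dims)
    \<comment> \<open>Comparing first entries, where the vector is \<open>1\<close>, pins down the factor.\<close>
    have "0 \<le> y $ 0" "\<bar>y $ 0\<bar> \<le> 1"
      using le carrier g0 by (force simp: conformal_le_def)+
    moreover have "y $ 0 \<noteq> 0"
    proof
      assume "y $ 0 = 0"
      then have "y = 0 \<cdot>\<^sub>v ?g" using multiple by metis
      also have "\<dots> = 0\<^sub>v (n + 2)" using g by (intro eq_vecI) auto
      finally show False using nz by contradiction
    qed
    ultimately have "y $ 0 = 1" by linarith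
    then show ?thesis using multiple by simp
  qed
  ultimately show ?thesis
    by (auto simp: graver_basis_def)
qed

lemma abs_index_le_inf_norm:
  assumes "i < dim_vec x"
  shows "\<bar>x $ i\<bar> \<le> inf_norm x"
  unfolding inf_norm_def using assms by (intro Max_ge) auto

theorem theorem3:
  shows "\<exists>A B C D :: int mat. four_block_data A B C D \<and> dim_row B = 1 \<and> dim_row D = 1 \<and>
    (\<exists>g :: nat \<Rightarrow> int vec.
       (\<forall>n \<ge> 1. g n \<in> graver_basis (nfold_matrix A B C D n)) \<and>
       (\<lambda>n. real_of_int (inf_norm (g n))) \<in> \<Omega>(\<lambda>n. real n))"
proof (intro exI conjI allI impI)
  show "four_block_data copy_A copy_B copy_C copy_D" "dim_row copy_B = 1" "dim_row copy_D = 1"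
    by (simp_all add: four_block_data_def copy_A_def copy_B_def copy_C_def copy_D_def)
  show "copy_sum_vec n \<in> graver_basis (nfold_matrix copy_A copy_B copy_C copy_D n)" for n
    by (rule copy_sum_vec_in_graver_basis)
  have "int n \<le> inf_norm (copy_sum_vec n)" for n
    using abs_index_le_inf_norm[of 1 "copy_sum_vec n"] by (simp add: copy_sum_vec_def)
  then have "real n \<le> \<bar>real_of_int (inf_norm (copy_sum_vec n))\<bar>" for n
    by (smt (verit) of_int_le_iff of_int_of_nat_eq)
  then show "(\<lambda>n. real_of_int (inf_norm (copy_sum_vec n))) \<in> \<Omega>(\<lambda>n. real n)"
    by (intro landau_omega.bigI[of 1] always_eventually) auto
qed

end
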